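(* Let $S(X)$: $F[\bar x\backslash U_1],\bigvee_{i=1}^pX(\alpha,t_i)\to\bigwedge_{j=1}^mX(r_j,\beta_j)\vdash G[\bar y\backslash U_2]$ be a schematic extended Herbrand sequent corresponding to a Herbrand sequent of a cut-free proof of $\forall\bar xF\vdash\exists\bar yG$ and a schematic $\Pi_2$-grammar covering the Herbrand term set. Let $\psi$ be a maximal $\mathbf{G3c}$-derivation of its reduced representation, $\mathcal A$ a starting set with $\mathrm{Sol}(\mathcal A)\neq\emptyset$ (defined with respect to $\psi$), $\mathcal C\in\mathrm{Sol}(\mathcal A)$, and $E=\mathrm{DNF}(\mathcal C)$ with set of variables exactly $\{x,y\}$. Then there exists a proof of $\forall\bar xF\vdash\exists\bar yG$ in $\mathbf{G3c}$ plus cut with exactly one cut, whose cut formula is $\forall x\exists y.E$.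
   Context: Sequents are pairs of sets of formulas; $\mathbf{G3c}$ is the invertible cut-free sequent calculus for classical first-order logic. A $\mathbf{G3c}$-derivation of a sequent is a tree of sequents rooted at it in which each node is the conclusion of a $\mathbf{G3c}$ rule with its children as premises; it is maximal if no leaf is the conclusion of a rule (for quantifier-free sequents the leaves consist of atoms; a leaf is tautological iff some atom occurs on both sides). Setting: $F,G$ quantifier-free formulas, $\bar x=(x_1,\dots,x_k)$, $\bar y=(y_1,\dots,y_l)$, $\forall\bar xF\vdash\exists\bar yG$ provable, $h_F,h_G$ fresh function symbols of arities $k,l$. A Herbrand term set of this sequent is $\{h_F(\bar t_1),\dots,h_F(\bar t_{k'}),h_G(\bar t_{k'+1}),\dots,h_G(\bar t_n)\}$ where $F[\bar x\backslash\bar t_1],\dots,F[\bar x\backslash\bar t_{k'}]\vdash G[\bar y\backslash\bar t_{k'+1}],\dots,G[\bar y\backslash\bar t_n]$ is valid (a Herbrand sequent). A schematic $\Pi_2$-grammar has nonterminals $\tau,\alpha,\beta_1,\dots,\beta_m$ (ordered $\beta_1<\dots<\beta_m<\alpha<\tau$) and productions $\tau\to h_F(\bar u_1)\mid\dots\mid h_F(\bar u_N)\mid h_G(\bar v_1)\mid\dots\mid h_G(\bar v_M)$ with variables of $\bar u_i$ among $\{\alpha\}$ and of $\bar v_j$ among $\{\beta_1,\dots,\beta_m\}$; $\alpha\to r_1\mid\dots\mid r_m$ with $r_1$ variable-free and variables of $r_j$ among $\{\beta_1,\dots,\beta_{j-1}\}$; $\beta_j\to t_1[\alpha\backslash r_j]\mid\dots\mid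 t_p[\alpha\backslash r_j]$ for terms $t_1,\dots,t_p$ with variables among $\{\alpha\}$. Its language consists of the ground terms derivable from $\tau$ by rigid derivations (each nonterminal is rewritten by one and the same production throughout the derivation); the grammar covers a Herbrand term set if the latter is contained in the language. Then, with $U_1=\{\bar u_1,\dots,\bar u_N\}$, $U_2=\{\bar v_1,\dots,\bar v_M\}$ and $X$ a binary predicate variable, $S(X)$ as in the claim is the schematic extended Herbrand sequent (here $F[\bar x\backslash U]$ is the list of instances), and $R: F[\bar x\backslash U_1]\vdash G[\bar y\backslash U_2]$ is its reduced representation. Leaves: for a sequent of atoms $P_1,\dots,P_i\vdash Q_1,\dots,Q_j$ put $D(\cdot)=\neg Q_1,\dots,\neg Q_j,P_1,\dots,P_i\vdash$; $\mathrm{DNTA}(\psi)=\{D(S'):S'$ a non-tautological leaf of $\psi\}$, each viewed as a set of literals. For $S\in\mathrm{DNTA}(\psi)$: $A(S)$ = literals containing $\alpha$; $B(S)$ = literals containing some $\beta_j$; $N(S)$ = literals containing neither $\alpha$ nor any $\beta_j$. $\overline L$ is the complementary literal and $\overline{M}=\{\overline L:L\in M\}$. A starting set is a finite set of finite sets of literals (clauses) with variables among designated variables $\{x,y\}$ not containing $\alpha,\beta_1,\dots,\beta_m$. For a finite set of clauses $\mathcal C$, $\mathrm{DNF}(\mathcal C)=\bigvee_{C\in\mathcal C}\bigwedge_{L\in C}L$. $\mathrm{Cl}(\mathcal A)$ is the set of $\mathcal C\subseteq\mathcal A$ such that for every $(C_1,\dots,C_m)\in\mathcal C^m$ and every $S\in\mathrm{DNTA}(\psi)$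 at least one holds: ($T_1$) $\exists i\,\exists L\in C_i$: $L[x\backslash r_i]\in\overline{N(S)}$; ($T_2$) $\exists i\,\exists L\in C_i$: $L[x\backslash r_i,y\backslash\beta_i]\in\overline{B(S)}$; ($T_3$) $\exists i,j\,\exists L\in C_i\,\exists Q\in C_j$: $L[x\backslash r_i,y\backslash\beta_i]=\overline Q[x\backslash r_j,y\backslash\beta_j]$. $A'(S)$ = set of literals $L$ with variables among $\{x,y\}$ such that $L[x\backslash\alpha,y\backslash t_i]\in A(S)$ for some $i$; $I(S)$ = set of subsets $M\subseteq A'(S)$ such that for some $i\in\{1,\dots,p\}$, $L[x\backslash\alpha,y\backslash t_i]\in A(S)$ for all $L\in M$. $\mathrm{Sol}(\mathcal A)$ is the set of $\mathcal C\in\mathrm{Cl}(\mathcal A)$ such that for every choice of literals $L_{C,i}\in C$ ($C\in\mathcal C$, $i\in\{1,\dots,p\}$) and every $S\in\mathrm{DNTA}(\psi)$ at least one holds: ($T'_1$) $\exists C\in\mathcal C\,\exists i$: $L_{C,i}[y\backslash t_i]\in N(S)$; ($T'_2$) $\exists C\in\mathcal C\,\exists I\in I(S)\,\forall i$: $L_{C,i}\in I$; ($T'_3$) $\exists C,D\in\mathcal C\,\exists i,j$: $L_{C,i}[x\backslash\alpha,y\backslash t_i]=\overline{L_{D,j}}[x\backslash\alpha,y\backslash t_j]$. *)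

theory Defs
  imports Main "HOL-Library.Multiset"
begin

section \<open>Syntax\<close>

type_synonym var = nat

datatype (funs_tm: 'f) tm = Var var | Fn 'f "'f tm list"

datatype (funs: 'f, preds: 'p) fm =
    Atom 'p "'f tm list"
  | Neg "('f, 'p) fm"
  | And "('f, 'p) fm" "('f, 'p) fm"
  | Or "('f, 'p) fm" "('f, 'p) fm"
  | Imp "('f, 'p) fm" "('f, 'p) fm"
  | Forall var "('f, 'p) fm"
  | Exists var "('f, 'p) fm"

type_synonym ('f, 'p) seq = "('f, 'p) fm set \<times> ('f, 'p) fm set"

primrec vars :: "'f tm \<Rightarrow> var set" where
  "vars (Var v) = {v}"
| "vars (Fn f ts) = \<Union> (set (map vars ts))"

primrec tsubst :: "(var \<Rightarrow> 'f tm) \<Rightarrow> 'f tm \<Rightarrow> 'f tm" where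
  "tsubst \<sigma> (Var v) = \<sigma> v"
| "tsubst \<sigma> (Fn f ts) = Fn f (map (tsubst \<sigma>) ts)"

primrec fv :: "('f, 'p) fm \<Rightarrow> var set" where
  "fv (Atom P ts) = \<Union> (vars ` set ts)"
| "fv (Neg A) = fv A"
| "fv (And A B) = fv A \<union> fv B"
| "fv (Or A B) = fv A \<union> fv B"
| "fv (Imp A B) = fv A \<union> fv B"
| "fv (Forall x A) = fv A - {x}"
| "fv (Exists x A) = fv A - {x}"

definition fv_seq :: "('f, 'p) seq \<Rightarrow> var set" where
  "fv_seq S = \<Union> (fv ` (fst S \<union> snd S))"

text \<open>Substitution replaces free occurrences simultaneously and does not rename bound
  variables. Capture is excluded by the side condition \<open>free_for\<close> of the quantifier rules;
  all other uses below are on quantifier-free formulas.\<close>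

primrec fsubst :: "(var \<Rightarrow> 'f tm) \<Rightarrow> ('f, 'p) fm \<Rightarrow> ('f, 'p) fm" where
  "fsubst \<sigma> (Atom P ts) = Atom P (map (tsubst \<sigma>) ts)"
| "fsubst \<sigma> (Neg A) = Neg (fsubst \<sigma> A)"
| "fsubst \<sigma> (And A B) = And (fsubst \<sigma> A) (fsubst \<sigma> B)"
| "fsubst \<sigma> (Or A B) = Or (fsubst \<sigma> A) (fsubst \<sigma> B)"
| "fsubst \<sigma> (Imp A B) = Imp (fsubst \<sigma> A) (fsubst \<sigma> B)"
| "fsubst \<sigma> (Forall x A) = Forall x (fsubst (\<sigma>(x := Var x)) A)"
| "fsubst \<sigma> (Exists x A) = Exists x (fsubst (\<sigma>(x := Var x)) A)"

primrec free_for :: "'f tm \<Rightarrow> var \<Rightarrow> ('f, 'p) fm \<Rightarrow> bool" where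
  "free_for t x (Atom P ts) \<longleftrightarrow> True"
| "free_for t x (Neg A) \<longleftrightarrow> free_for t x A"
| "free_for t x (And A B) \<longleftrightarrow> free_for t x A \<and> free_for t x B"
| "free_for t x (Or A B) \<longleftrightarrow> free_for t x A \<and> free_for t x B"
| "free_for t x (Imp A B) \<longleftrightarrow> free_for t x A \<and> free_for t x B"
| "free_for t x (Forall z A) \<longleftrightarrow> x \<notin> fv (Forall z A) \<or> z \<notin> vars t \<and> free_for t x A"
| "free_for t x (Exists z A) \<longleftrightarrow> x \<notin> fv (Exists z A) \<or> z \<notin> vars t \<and> free_for t x A"

primrec qfree :: "('f, 'p) fm \<Rightarrow> bool" where
  "qfree (Atom P ts) \<longleftrightarrow> True"
| "qfree (Neg A) \<longleftrightarrow> qfree A"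
| "qfree (And A B) \<longleftrightarrow> qfree A \<and> qfree B"
| "qfree (Or A B) \<longleftrightarrow> qfree A \<and> qfree B"
| "qfree (Imp A B) \<longleftrightarrow> qfree A \<and> qfree B"
| "qfree (Forall x A) \<longleftrightarrow> False"
| "qfree (Exists x A) \<longleftrightarrow> False"

abbreviation Foralls :: "var list \<Rightarrow> ('f, 'p) fm \<Rightarrow> ('f, 'p) fm" where
  "Foralls xs A \<equiv> foldr Forall xs A"

abbreviation Existss :: "var list \<Rightarrow> ('f, 'p) fm \<Rightarrow> ('f, 'p) fm" where
  "Existss xs A \<equiv> foldr Exists xs A"

definition inst :: "var list \<Rightarrow> 'f tm list \<Rightarrow> ('f, 'p) fm \<Rightarrow> ('f, 'p) fm" where
  "inst xs ts A =
     fsubst (\<lambda>v. case map_of (zip xs ts) v of Some t \<Rightarrow> t | None \<Rightarrow> Var v) A"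

abbreviation subst1 :: "var \<Rightarrow> 'f tm \<Rightarrow> ('f, 'p) fm \<Rightarrow> ('f, 'p) fm" where
  "subst1 x s A \<equiv> fsubst (Var(x := s)) A"

abbreviation subst2 :: "var \<Rightarrow> 'f tm \<Rightarrow> var \<Rightarrow> 'f tm \<Rightarrow> ('f, 'p) fm \<Rightarrow> ('f, 'p) fm" where
  "subst2 x s y t A \<equiv> fsubst (Var(x := s, y := t)) A"

text \<open>The language has no propositional constants. The empty conjunction is therefore rendered
  by a closed tautology and the empty disjunction by its negation; which one is immaterial.\<close>

fun Conjs :: "('f, 'p) fm list \<Rightarrow> ('f, 'p) fm" where
  "Conjs [] = Imp (Atom undefined []) (Atom undefined [])"
| "Conjs [A] = A"
| "Conjs (A # As) = And A (Conjs As)"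

fun Disjs :: "('f, 'p) fm list \<Rightarrow> ('f, 'p) fm" where
  "Disjs [] = Neg (Imp (Atom undefined []) (Atom undefined []))"
| "Disjs [A] = A"
| "Disjs (A # As) = Or A (Disjs As)"


section \<open>Validity\<close>

primrec teval :: "('f \<Rightarrow> 'd list \<Rightarrow> 'd) \<Rightarrow> (var \<Rightarrow> 'd) \<Rightarrow> 'f tm \<Rightarrow> 'd" where
  "teval I e (Var v) = e v"
| "teval I e (Fn f ts) = I f (map (teval I e) ts)"

primrec sat :: "'d set \<Rightarrow> ('f \<Rightarrow> 'd list \<Rightarrow> 'd) \<Rightarrow> ('p \<Rightarrow> 'd list \<Rightarrow> bool) \<Rightarrow> (var \<Rightarrow> 'd)
    \<Rightarrow> ('f, 'p) fm \<Rightarrow> bool" where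
  "sat D I J e (Atom P ts) \<longleftrightarrow> J P (map (teval I e) ts)"
| "sat D I J e (Neg A) \<longleftrightarrow> \<not> sat D I J e A"
| "sat D I J e (And A B) \<longleftrightarrow> sat D I J e A \<and> sat D I J e B"
| "sat D I J e (Or A B) \<longleftrightarrow> sat D I J e A \<or> sat D I J e B"
| "sat D I J e (Imp A B) \<longleftrightarrow> (sat D I J e A \<longrightarrow> sat D I J e B)"
| "sat D I J e (Forall x A) \<longleftrightarrow> (\<forall>d\<in>D. sat D I J (e(x := d)) A)"
| "sat D I J e (Exists x A) \<longleftrightarrow> (\<exists>d\<in>D. sat D I J (e(x := d)) A)"

text \<open>Only finite sequents are tested for validity; by the Loewenheim-Skolem theorem it is
  enough for them to consider countable universes.\<close>

definition valid :: "('f, 'p) seq \<Rightarrow> bool" where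
  "valid S \<longleftrightarrow>
     (\<forall>(D :: nat set) I J e.
        (\<forall>f ds. set ds \<subseteq> D \<longrightarrow> I f ds \<in> D) \<longrightarrow> range e \<subseteq> D \<longrightarrow>
        (\<forall>A\<in>fst S. sat D I J e A) \<longrightarrow> (\<exists>B\<in>snd S. sat D I J e B))"


section \<open>The calculus\<close>

text \<open>The inferences of \<open>G3c\<close> with at least one premise, as a relation between the list of
  premises and the conclusion. As sequents consist of sets, the context may contain the
  principal formula.\<close>

inductive G3c_rule :: "('f, 'p) seq list \<Rightarrow> ('f, 'p) seq \<Rightarrow> bool" where
  NegL: "G3c_rule [(\<Gamma>, insert A \<Delta>)] (insert (Neg A) \<Gamma>, \<Delta>)"
| NegR: "G3c_rule [(insert A \<Gamma>, \<Delta>)] (\<Gamma>, insert (Neg A) \<Delta>)"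
| AndL: "G3c_rule [(insert A (insert B \<Gamma>), \<Delta>)] (insert (And A B) \<Gamma>, \<Delta>)"
| AndR: "G3c_rule [(\<Gamma>, insert A \<Delta>), (\<Gamma>, insert B \<Delta>)] (\<Gamma>, insert (And A B) \<Delta>)"
| OrL: "G3c_rule [(insert A \<Gamma>, \<Delta>), (insert B \<Gamma>, \<Delta>)] (insert (Or A B) \<Gamma>, \<Delta>)"
| OrR: "G3c_rule [(\<Gamma>, insert A (insert B \<Delta>))] (\<Gamma>, insert (Or A B) \<Delta>)"
| ImpL: "G3c_rule [(\<Gamma>, insert A \<Delta>), (insert B \<Gamma>, \<Delta>)] (insert (Imp A B) \<Gamma>, \<Delta>)"
| ImpR: "G3c_rule [(insert A \<Gamma>, insert B \<Delta>)] (\<Gamma>, insert (Imp A B) \<Delta>)"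
| ForallL: "free_for t x A \<Longrightarrow>
    G3c_rule [(insert (subst1 x t A) (insert (Forall x A) \<Gamma>), \<Delta>)] (insert (Forall x A) \<Gamma>, \<Delta>)"
| ForallR: "free_for (Var a) x A \<Longrightarrow> a \<notin> fv_seq (\<Gamma>, insert (Forall x A) \<Delta>) \<Longrightarrow>
    G3c_rule [(\<Gamma>, insert (subst1 x (Var a) A) \<Delta>)] (\<Gamma>, insert (Forall x A) \<Delta>)"
| ExistsL: "free_for (Var a) x A \<Longrightarrow> a \<notin> fv_seq (insert (Exists x A) \<Gamma>, \<Delta>) \<Longrightarrow>
    G3c_rule [(insert (subst1 x (Var a) A) \<Gamma>, \<Delta>)] (insert (Exists x A) \<Gamma>, \<Delta>)"
| ExistsR: "free_for t x A \<Longrightarrow>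
    G3c_rule [(\<Gamma>, insert (subst1 x t A) (insert (Exists x A) \<Delta>))] (\<Gamma>, insert (Exists x A) \<Delta>)"

text \<open>\<open>G3c_cut_proof M S\<close>: there is a proof of \<open>S\<close> in \<open>G3c\<close> plus cut such that the cut formulas
  of its cut inferences, counted with multiplicity, form the multiset \<open>M\<close>. Hence \<open>M = {#}\<close> means
  a cut-free proof and \<open>M = {#A#}\<close> a proof with exactly one cut, whose cut formula is \<open>A\<close>.\<close>

inductive G3c_cut_proof :: "('f, 'p) fm multiset \<Rightarrow> ('f, 'p) seq \<Rightarrow> bool" where
  Ax: "G3c_cut_proof {#} (insert (Atom P ts) \<Gamma>, insert (Atom P ts) \<Delta>)"
| Rule: "G3c_rule Ss S \<Longrightarrow> list_all2 G3c_cut_proof Ms Ss \<Longrightarrow> G3c_cut_proof (sum_list Ms) S"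
| Cut: "G3c_cut_proof M\<^sub>1 (\<Gamma>\<^sub>1, insert A \<Delta>\<^sub>1) \<Longrightarrow> G3c_cut_proof M\<^sub>2 (insert A \<Gamma>\<^sub>2, \<Delta>\<^sub>2) \<Longrightarrow>
    G3c_cut_proof (add_mset A (M\<^sub>1 + M\<^sub>2)) (\<Gamma>\<^sub>1 \<union> \<Gamma>\<^sub>2, \<Delta>\<^sub>1 \<union> \<Delta>\<^sub>2)"

datatype ('f, 'p) dtree = Node (dtree_root: "('f, 'p) seq") "('f, 'p) dtree list"

inductive G3c_derivation :: "('f, 'p) dtree \<Rightarrow> bool" where
  Leaf: "G3c_derivation (Node S [])"
| Inner: "G3c_rule (map dtree_root \<psi>s) S \<Longrightarrow> (\<And>\<psi>. \<psi> \<in> set \<psi>s \<Longrightarrow> G3c_derivation \<psi>) \<Longrightarrow>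
    G3c_derivation (Node S \<psi>s)"

fun leaves :: "('f, 'p) dtree \<Rightarrow> ('f, 'p) seq set" where
  "leaves (Node S []) = {S}"
| "leaves (Node S \<psi>s) = (\<Union>\<psi>\<in>set \<psi>s. leaves \<psi>)"

definition maximal :: "('f, 'p) dtree \<Rightarrow> bool" where
  "maximal \<psi> \<longleftrightarrow> (\<forall>S\<in>leaves \<psi>. \<nexists>Ss. G3c_rule Ss S)"

definition tautological :: "('f, 'p) seq \<Rightarrow> bool" where
  "tautological S \<longleftrightarrow> (\<exists>P ts. Atom P ts \<in> fst S \<inter> snd S)"


section \<open>Herbrand term sets and schematic grammars\<close>

definition Herbrand_term_set ::
  "var list \<Rightarrow> ('f, 'p) fm \<Rightarrow> var list \<Rightarrow> ('f, 'p) fm \<Rightarrow> 'f \<Rightarrow> 'f \<Rightarrow> 'f tm set \<Rightarrow> bool" where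
  "Herbrand_term_set xs F ys G h\<^sub>F h\<^sub>G H \<longleftrightarrow>
     (\<exists>T\<^sub>F T\<^sub>G. finite T\<^sub>F \<and> finite T\<^sub>G \<and>
        (\<forall>ts\<in>T\<^sub>F. length ts = length xs) \<and> (\<forall>ts\<in>T\<^sub>G. length ts = length ys) \<and>
        valid ((\<lambda>ts. inst xs ts F) ` T\<^sub>F, (\<lambda>ts. inst ys ts G) ` T\<^sub>G) \<and>
        H = Fn h\<^sub>F ` T\<^sub>F \<union> Fn h\<^sub>G ` T\<^sub>G)"

text \<open>Nonterminals are variables. The lists \<open>u_tuples\<close>, \<open>v_tuples\<close>, \<open>r_terms\<close>, \<open>t_terms\<close> hold
  the tuples \<open>u\<^sub>1, \<dots>, u\<^sub>N\<close> and \<open>v\<^sub>1, \<dots>, v\<^sub>M\<close> and the terms \<open>r\<^sub>1, \<dots>, r\<^sub>m\<close> and \<open>t\<^sub>1, \<dots>, t\<^sub>p\<close>; all indices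
  are shifted to start from 0.\<close>

record 'f grammar =
  tau :: var
  alpha :: var
  betas :: "var list"
  u_tuples :: "'f tm list list"
  v_tuples :: "'f tm list list"
  r_terms :: "'f tm list"
  t_terms :: "'f tm list"

definition schematic_Pi2_grammar :: "nat \<Rightarrow> nat \<Rightarrow> 'f grammar \<Rightarrow> bool" where
  "schematic_Pi2_grammar k l \<G> \<longleftrightarrow>
     distinct (tau \<G> # alpha \<G> # betas \<G>) \<and>
     (\<forall>u\<in>set (u_tuples \<G>). length u = k \<and> (\<forall>t\<in>set u. vars t \<subseteq> {alpha \<G>})) \<and>
     (\<forall>v\<in>set (v_tuples \<G>). length v = l \<and> (\<forall>t\<in>set v. vars t \<subseteq> set (betas \<G>))) \<and>
     length (r_terms \<G>) = length (betas \<G>) \<and>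
     (\<forall>j<length (r_terms \<G>). vars (r_terms \<G> ! j) \<subseteq> set (take j (betas \<G>))) \<and>
     (\<forall>t\<in>set (t_terms \<G>). vars t \<subseteq> {alpha \<G>})"

definition productions :: "'f \<Rightarrow> 'f \<Rightarrow> 'f grammar \<Rightarrow> (var \<times> 'f tm) set" where
  "productions h\<^sub>F h\<^sub>G \<G> =
     {(tau \<G>, Fn h\<^sub>F u) | u. u \<in> set (u_tuples \<G>)} \<union>
     {(tau \<G>, Fn h\<^sub>G v) | v. v \<in> set (v_tuples \<G>)} \<union>
     {(alpha \<G>, r) | r. r \<in> set (r_terms \<G>)} \<union>
     {(betas \<G> ! j, tsubst (Var(alpha \<G> := r_terms \<G> ! j)) t) | j t.
        j < length (betas \<G>) \<and> t \<in> set (t_terms \<G>)}"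

text \<open>One rewrite step at a single occurrence of a nonterminal. The function \<open>\<pi>\<close> fixes the
  production used for each nonterminal, which makes derivations rigid.\<close>

inductive rigid_step :: "(var \<times> 'f tm) set \<Rightarrow> (var \<Rightarrow> 'f tm) \<Rightarrow> 'f tm \<Rightarrow> 'f tm \<Rightarrow> bool"
  for \<P> \<pi> where
  "(A, \<pi> A) \<in> \<P> \<Longrightarrow> rigid_step \<P> \<pi> (Var A) (\<pi> A)"
| "rigid_step \<P> \<pi> s t \<Longrightarrow> rigid_step \<P> \<pi> (Fn f (as @ s # bs)) (Fn f (as @ t # bs))"

definition language :: "'f \<Rightarrow> 'f \<Rightarrow> 'f grammar \<Rightarrow> 'f tm set" where
  "language h\<^sub>F h\<^sub>G \<G> =
     {t. vars t = {} \<and> (\<exists>\<pi>. (rigid_step (productions h\<^sub>F h\<^sub>G \<G>) \<pi>)\<^sup>*\<^sup>* (Var (tau \<G>)) t)}"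

definition reduced_representation ::
  "var list \<Rightarrow> ('f, 'p) fm \<Rightarrow> var list \<Rightarrow> ('f, 'p) fm \<Rightarrow> 'f grammar \<Rightarrow> ('f, 'p) seq" where
  "reduced_representation xs F ys G \<G> =
     ((\<lambda>u. inst xs u F) ` set (u_tuples \<G>), (\<lambda>v. inst ys v G) ` set (v_tuples \<G>))"

text \<open>The predicate variable \<open>X\<close> is represented by the function that maps a pair of terms to the
  formula \<open>X(s, t)\<close>.\<close>

definition schematic_extended_Herbrand_sequent ::
  "var list \<Rightarrow> ('f, 'p) fm \<Rightarrow> var list \<Rightarrow> ('f, 'p) fm \<Rightarrow> 'f grammar \<Rightarrow>
   ('f tm \<Rightarrow> 'f tm \<Rightarrow> ('f, 'p) fm) \<Rightarrow> ('f, 'p) seq" where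
  "schematic_extended_Herbrand_sequent xs F ys G \<G> X =
     (insert (Imp (Disjs (map (\<lambda>t. X (Var (alpha \<G>)) t) (t_terms \<G>)))
                  (Conjs (map (\<lambda>(r, b). X r (Var b)) (zip (r_terms \<G>) (betas \<G>)))))
        ((\<lambda>u. inst xs u F) ` set (u_tuples \<G>)),
      (\<lambda>v. inst ys v G) ` set (v_tuples \<G>))"


section \<open>Leaves, starting sets and solutions\<close>

definition literal :: "('f, 'p) fm \<Rightarrow> bool" where
  "literal L \<longleftrightarrow> (\<exists>P ts. L = Atom P ts \<or> L = Neg (Atom P ts))"

text \<open>The complementary literal; only meaningful on literals.\<close>

fun dual :: "('f, 'p) fm \<Rightarrow> ('f, 'p) fm" where
  "dual (Neg A) = A"
| "dual A = Neg A"

definition DNTA :: "('f, 'p) dtree \<Rightarrow> ('f, 'p) fm set set" where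
  "DNTA \<psi> = {Neg ` \<Delta> \<union> \<Gamma> | \<Gamma> \<Delta>. (\<Gamma>, \<Delta>) \<in> leaves \<psi> \<and> \<not> tautological (\<Gamma>, \<Delta>)}"

definition A_part :: "'f grammar \<Rightarrow> ('f, 'p) fm set \<Rightarrow> ('f, 'p) fm set" where
  "A_part \<G> S = {L \<in> S. alpha \<G> \<in> fv L}"

definition B_part :: "'f grammar \<Rightarrow> ('f, 'p) fm set \<Rightarrow> ('f, 'p) fm set" where
  "B_part \<G> S = {L \<in> S. fv L \<inter> set (betas \<G>) \<noteq> {}}"

definition N_part :: "'f grammar \<Rightarrow> ('f, 'p) fm set \<Rightarrow> ('f, 'p) fm set" where
  "N_part \<G> S = {L \<in> S. alpha \<G> \<notin> fv L \<and> fv L \<inter> set (betas \<G>) = {}}"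

definition starting_set :: "var \<Rightarrow> var \<Rightarrow> ('f, 'p) fm set set \<Rightarrow> bool" where
  "starting_set x y \<A> \<longleftrightarrow>
     finite \<A> \<and> (\<forall>C\<in>\<A>. finite C \<and> (\<forall>L\<in>C. literal L \<and> fv L \<subseteq> {x, y}))"

text \<open>\<open>is_DNF \<C> E\<close>: for some enumeration without repetition of \<open>\<C>\<close> and of each of its elements,
  \<open>E\<close> is the disjunction of the conjunctions.\<close>

definition is_DNF :: "('f, 'p) fm set set \<Rightarrow> ('f, 'p) fm \<Rightarrow> bool" where
  "is_DNF \<C> E \<longleftrightarrow>
     (\<exists>Cs. set (map set Cs) = \<C> \<and> distinct (map set Cs) \<and> (\<forall>Ls\<in>set Cs. distinct Ls) \<and>
        E = Disjs (map Conjs Cs))"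

definition Cl ::
  "'f grammar \<Rightarrow> var \<Rightarrow> var \<Rightarrow> ('f, 'p) dtree \<Rightarrow> ('f, 'p) fm set set \<Rightarrow> ('f, 'p) fm set set set"
  where
  "Cl \<G> x y \<psi> \<A> = {\<C>. \<C> \<subseteq> \<A> \<and>
     (let m = length (betas \<G>); r = (\<lambda>i. r_terms \<G> ! i); \<beta> = (\<lambda>i. Var (betas \<G> ! i)) in
      \<forall>Cs. length Cs = m \<and> set Cs \<subseteq> \<C> \<longrightarrow> (\<forall>S\<in>DNTA \<psi>.
        (\<exists>i<m. \<exists>L\<in>Cs ! i. subst1 x (r i) L \<in> dual ` N_part \<G> S) \<or>
        (\<exists>i<m. \<exists>L\<in>Cs ! i. subst2 x (r i) y (\<beta> i) L \<in> dual ` B_part \<G> S) \<or>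
        (\<exists>i<m. \<exists>j<m. \<exists>L\<in>Cs ! i. \<exists>Q\<in>Cs ! j.
           subst2 x (r i) y (\<beta> i) L = subst2 x (r j) y (\<beta> j) (dual Q))))}"

definition A' :: "'f grammar \<Rightarrow> var \<Rightarrow> var \<Rightarrow> ('f, 'p) fm set \<Rightarrow> ('f, 'p) fm set" where
  "A' \<G> x y S = {L. literal L \<and> fv L \<subseteq> {x, y} \<and>
     (\<exists>i<length (t_terms \<G>). subst2 x (Var (alpha \<G>)) y (t_terms \<G> ! i) L \<in> A_part \<G> S)}"

definition I_sets :: "'f grammar \<Rightarrow> var \<Rightarrow> var \<Rightarrow> ('f, 'p) fm set \<Rightarrow> ('f, 'p) fm set set" where
  "I_sets \<G> x y S = {M. M \<subseteq> A' \<G> x y S \<and>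
     (\<exists>i<length (t_terms \<G>). \<forall>L\<in>M. subst2 x (Var (alpha \<G>)) y (t_terms \<G> ! i) L \<in> A_part \<G> S)}"

definition Sol ::
  "'f grammar \<Rightarrow> var \<Rightarrow> var \<Rightarrow> ('f, 'p) dtree \<Rightarrow> ('f, 'p) fm set set \<Rightarrow> ('f, 'p) fm set set set"
  where
  "Sol \<G> x y \<psi> \<A> = {\<C> \<in> Cl \<G> x y \<psi> \<A>.
     (let p = length (t_terms \<G>); t = (\<lambda>i. t_terms \<G> ! i); \<alpha> = Var (alpha \<G>) in
      \<forall>L. (\<forall>C\<in>\<C>. \<forall>i<p. L C i \<in> C) \<longrightarrow> (\<forall>S\<in>DNTA \<psi>.
        (\<exists>C\<in>\<C>. \<exists>i<p. subst1 y (t i) (L C i) \<in> N_part \<G> S) \<or>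
        (\<exists>C\<in>\<C>. \<exists>I\<in>I_sets \<G> x y S. \<forall>i<p. L C i \<in> I) \<or>
        (\<exists>C\<in>\<C>. \<exists>D\<in>\<C>. \<exists>i<p. \<exists>j<p.
           subst2 x \<alpha> y (t i) (L C i) = subst2 x \<alpha> y (t j) (dual (L D j)))))}"

end

theory Submission
  imports Defs
begin

text \<open>Cut introduction splits the claim into two cut-free sequents: \<open>F[U\<^sub>1] \<turnstile> G[U\<^sub>2], E(\<alpha>, t\<^sub>i)\<close>
  (all \<open>i\<close> on the right) and \<open>F[U\<^sub>1], E(r\<^sub>j, \<beta>\<^sub>j) \<turnstile> G[U\<^sub>2]\<close> (all \<open>j\<close> on the left). Both are
  quantifier-free, so it suffices to check them propositionally. An assignment refuting the
  reduced representation refutes a non-tautological leaf of \<open>\<psi>\<close>, hence satisfies an element of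
  \<open>DNTA \<psi>\<close>. If all \<open>E(r\<^sub>j, \<beta>\<^sub>j)\<close> were true, the true clauses would contradict \<open>T\<^sub>1\<close>--\<open>T\<^sub>3\<close>; if all
  \<open>E(\<alpha>, t\<^sub>i)\<close> were false, the false literals would contradict \<open>T'\<^sub>1\<close>--\<open>T'\<^sub>3\<close>. The eigenvariables are
  \<open>\<alpha>\<close> on the left of the cut and \<open>\<beta>\<^sub>1, \<dots>, \<beta>\<^sub>m\<close>, introduced in this order from the root upwards,
  on the right.\<close>

section \<open>Substitution\<close>

lemma tsubst_cong: "(\<And>v. v \<in> vars t \<Longrightarrow> \<sigma> v = \<theta> v) \<Longrightarrow> tsubst \<sigma> t = tsubst \<theta> t"
  by (induction t) auto

lemma tsubst_Var [simp]: "tsubst Var t = t"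
  by (induction t) (auto intro: map_idI)

lemma vars_tsubst: "vars (tsubst \<sigma> t) = (\<Union>v\<in>vars t. vars (\<sigma> v))"
  by (induction t) auto

lemma tsubst_tsubst: "tsubst \<sigma> (tsubst \<theta> t) = tsubst (\<lambda>v. tsubst \<sigma> (\<theta> v)) t"
  by (induction t) auto

lemma fsubst_cong: "(\<And>v. v \<in> fv A \<Longrightarrow> \<sigma> v = \<theta> v) \<Longrightarrow> fsubst \<sigma> A = fsubst \<theta> A"
proof (induction A arbitrary: \<sigma> \<theta>)
  case (Forall z A)
  have "fsubst (\<sigma>(z := Var z)) A = fsubst (\<theta>(z := Var z)) A"
    by (rule Forall.IH) (use Forall.prems in auto)
  then show ?case by simp
next
  case (Exists z A)
  have "fsubst (\<sigma>(z := Var z)) A = fsubst (\<theta>(z := Var z)) A"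
    by (rule Exists.IH) (use Exists.prems in auto)
  then show ?case by simp
next
  case (Atom P ts)
  then show ?case by (auto intro: tsubst_cong)
next
  case (Neg A)
  from Neg.IH[of \<sigma> \<theta>] Neg.prems show ?case by simp
next
  case (And A B)
  from And.IH[of \<sigma> \<theta>] And.prems show ?case by simp
next
  case (Or A B)
  from Or.IH[of \<sigma> \<theta>] Or.prems show ?case by simp
next
  case (Imp A B)
  from Imp.IH[of \<sigma> \<theta>] Imp.prems show ?case by simp
qed

text \<open>Substitution does not rename bound variables, so under a quantifier a term brought in by
  \<open>\<theta>\<close> could be captured and composition could fail; without quantifiers this
  cannot happen.\<close>

lemma fsubst_fsubst_qfree:
  "qfree A \<Longrightarrow> fsubst \<sigma> (fsubst \<theta> A) = fsubst (\<lambda>v. tsubst \<sigma> (\<theta> v)) A"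
  by (induction A) (auto simp: tsubst_tsubst)

lemma fv_fsubst_qfree: "qfree A \<Longrightarrow> fv (fsubst \<sigma> A) = (\<Union>v\<in>fv A. vars (\<sigma> v))"
  by (induction A) (auto simp: vars_tsubst)

lemma qfree_fsubst [simp]: "qfree (fsubst \<sigma> A) = qfree A"
  by (induction A arbitrary: \<sigma>) auto

lemma qfree_inst [simp]: "qfree (inst zs ts A) = qfree A"
  by (simp add: inst_def)

lemma free_for_qfree: "qfree A \<Longrightarrow> free_for t z A"
  by (induction A) auto

section \<open>Instances of quantifier prefixes\<close>

lemma fsubst_Foralls:
  "z \<notin> set zs \<Longrightarrow> fsubst (Var(z := t)) (Foralls zs A) = Foralls zs (subst1 z t A)"
  by (induction zs) (auto simp: fun_upd_idem)

lemma fsubst_Existss: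
  "z \<notin> set zs \<Longrightarrow> fsubst (Var(z := t)) (Existss zs A) = Existss zs (subst1 z t A)"
  by (induction zs) (auto simp: fun_upd_idem)

lemma fv_Foralls [simp]: "fv (Foralls zs A) = fv A - set zs"
  by (induction zs) auto

lemma fv_Existss [simp]: "fv (Existss zs A) = fv A - set zs"
  by (induction zs) auto

lemma free_for_Foralls:
  "qfree A \<Longrightarrow> vars t \<inter> set zs = {} \<Longrightarrow> free_for t z (Foralls zs A)"
  by (induction zs) (auto simp: free_for_qfree)

lemma free_for_Existss:
  "qfree A \<Longrightarrow> vars t \<inter> set zs = {} \<Longrightarrow> free_for t z (Existss zs A)"
  by (induction zs) (auto simp: free_for_qfree)

lemma inst_Nil [simp]: "inst [] ts A = fsubst Var A"
  by (simp add: inst_def)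

lemma fsubst_Var_qfree [simp]: "qfree A \<Longrightarrow> fsubst Var A = A"
  by (induction A) (auto intro: map_idI)

text \<open>Links the removal of quantifiers one by one with the simultaneous substitution of a
  whole tuple: the two agree because \<open>t\<close> contains none of the variables
  \<open>zs\<close> still to be replaced.\<close>

lemma inst_Cons:
  assumes "qfree A" and "z \<notin> set zs" and "vars t \<inter> set zs = {}" and "length zs = length ts"
  shows "inst zs ts (subst1 z t A) = inst (z # zs) (t # ts) A"
proof -
  let ?\<sigma> = "\<lambda>v. case map_of (zip zs ts) v of Some t \<Rightarrow> t | None \<Rightarrow> Var v"
  have id: "?\<sigma> v = Var v" if "v \<notin> set zs" for v
    using that assms(4) by (auto split: option.split dest: map_of_SomeD set_zip_leftD)
  have "tsubst ?\<sigma> t = tsubst Var t"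
    by (rule tsubst_cong) (use assms(3) id in blast)
  then show ?thesis
    unfolding inst_def fsubst_fsubst_qfree[OF assms(1)]
    by (intro fsubst_cong) auto
qed

lemma fv_inst_subset:
  assumes "qfree A" and "length ts = length zs"
  shows "fv (inst zs ts A) \<subseteq> (fv A - set zs) \<union> (\<Union>t\<in>set ts. vars t)"
proof
  fix w assume "w \<in> fv (inst zs ts A)"
  then obtain v where v: "v \<in> fv A"
    and w: "w \<in> vars (case map_of (zip zs ts) v of Some t \<Rightarrow> t | None \<Rightarrow> Var v)"
    using assms(1) by (auto simp: inst_def fv_fsubst_qfree)
  show "w \<in> (fv A - set zs) \<union> (\<Union>t\<in>set ts. vars t)"
  proof (cases "map_of (zip zs ts) v")
    case None
    then have "v \<notin> set zs"
      using assms(2) by (metis map_of_zip_is_None)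
    then show ?thesis using None v w by simp
  next
    case (Some t)
    then have "t \<in> set ts" by (auto dest: map_of_SomeD set_zip_rightD)
    then show ?thesis using Some w by auto
  qed
qed

section \<open>Iterated conjunctions and disjunctions\<close>

lemma fsubst_Conjs: "fsubst \<sigma> (Conjs As) = Conjs (map (fsubst \<sigma>) As)"
  by (induction As rule: Conjs.induct) auto

lemma fsubst_Disjs: "fsubst \<sigma> (Disjs As) = Disjs (map (fsubst \<sigma>) As)"
  by (induction As rule: Disjs.induct) auto

lemma qfree_Conjs: "(\<And>A. A \<in> set As \<Longrightarrow> qfree A) \<Longrightarrow> qfree (Conjs As)"
  by (induction As rule: Conjs.induct) auto

lemma qfree_Disjs: "(\<And>A. A \<in> set As \<Longrightarrow> qfree A) \<Longrightarrow> qfree (Disjs As)"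
  by (induction As rule: Disjs.induct) auto


section \<open>Propositional assignments\<close>

text \<open>In the term structure with the identity as environment every term denotes itself, so \<open>v\<close>
  is an arbitrary truth assignment to the atoms, free variables being treated as constants.\<close>

abbreviation holds :: "('p \<Rightarrow> 'f tm list \<Rightarrow> bool) \<Rightarrow> ('f, 'p) fm \<Rightarrow> bool" where
  "holds v A \<equiv> sat UNIV Fn v Var A"

definition refutes :: "('p \<Rightarrow> 'f tm list \<Rightarrow> bool) \<Rightarrow> ('f, 'p) seq \<Rightarrow> bool" where
  "refutes v S \<longleftrightarrow> (\<forall>A\<in>fst S. holds v A) \<and> (\<forall>B\<in>snd S. \<not> holds v B)"

definition qfree_seq :: "('f, 'p) seq \<Rightarrow> bool" where
  "qfree_seq S \<longleftrightarrow> (\<forall>A\<in>fst S \<union> snd S. qfree A)"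

lemma teval_term_structure [simp]: "teval Fn Var t = t"
  by (induction t) (auto intro: map_idI)

lemma map_teval_term_structure [simp]: "map (teval Fn Var) ts = ts"
  by (auto intro: map_idI)

text \<open>The empty case has the form \<open>Imp A A\<close>, which every \<open>v\<close> makes
  true, whatever the atom; dually \<open>Disjs []\<close> is always false.\<close>

lemma holds_Conjs: "holds v (Conjs As) \<longleftrightarrow> (\<forall>A\<in>set As. holds v A)"
  by (induction As rule: Conjs.induct) auto

lemma holds_Disjs: "holds v (Disjs As) \<longleftrightarrow> (\<exists>A\<in>set As. holds v A)"
  by (induction As rule: Disjs.induct) auto

lemma literal_qfree: "literal L \<Longrightarrow> qfree L"
  by (auto simp: literal_def)

lemma holds_dual: "literal L \<Longrightarrow> holds v (dual L) \<longleftrightarrow> \<not> holds v L"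
  by (auto simp: literal_def)

lemma fv_dual: "literal L \<Longrightarrow> fv (dual L) = fv L"
  by (auto simp: literal_def)

text \<open>The form required by \<open>T\<^sub>3\<close> and \<open>T'\<^sub>3\<close>, where a
  literal is dualised before the substitution is applied.\<close>

lemma holds_fsubst_dual:
  "literal L \<Longrightarrow> holds v (fsubst \<sigma> (dual L)) \<longleftrightarrow> \<not> holds v (fsubst \<sigma> L)"
  by (auto simp: literal_def)

lemma is_DNF_qfree:
  assumes "is_DNF \<C> E" and "\<And>C L. C \<in> \<C> \<Longrightarrow> L \<in> C \<Longrightarrow> literal L"
  shows "qfree E"
proof -
  obtain Cs where "set (map set Cs) = \<C>" and "E = Disjs (map Conjs Cs)"
    using assms(1) unfolding is_DNF_def by blast
  then show ?thesis
    using assms(2) by (fastforce intro!: qfree_Disjs qfree_Conjs dest: literal_qfree)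
qed

lemma holds_fsubst_DNF:
  assumes "is_DNF \<C> E"
  shows "holds v (fsubst \<sigma> E) \<longleftrightarrow> (\<exists>C\<in>\<C>. \<forall>L\<in>C. holds v (fsubst \<sigma> L))"
proof -
  obtain Cs where "set (map set Cs) = \<C>" and "E = Disjs (map Conjs Cs)"
    using assms unfolding is_DNF_def by blast
  then show ?thesis
    by (auto simp: fsubst_Disjs fsubst_Conjs holds_Disjs holds_Conjs)
qed


section \<open>Provability in every larger sequent\<close>

text \<open>Closing under supersets replaces weakening, which would need a renaming of eigenvariables.\<close>

definition stably_provable :: "('f, 'p) fm set \<Rightarrow> ('f, 'p) fm set \<Rightarrow> bool" where
  "stably_provable \<Gamma> \<Delta> \<longleftrightarrow>
     (\<forall>\<Gamma>' \<Delta>'. \<Gamma> \<subseteq> \<Gamma>' \<longrightarrow> \<Delta> \<subseteq> \<Delta>' \<longrightarrow> G3c_cut_proof {#} (\<Gamma>', \<Delta>'))"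

lemma stably_provableI:
  "(\<And>\<Gamma>' \<Delta>'. \<Gamma> \<subseteq> \<Gamma>' \<Longrightarrow> \<Delta> \<subseteq> \<Delta>' \<Longrightarrow> G3c_cut_proof {#} (\<Gamma>', \<Delta>')) \<Longrightarrow> stably_provable \<Gamma> \<Delta>"
  by (simp add: stably_provable_def)

lemma stably_provableD:
  "stably_provable \<Gamma> \<Delta> \<Longrightarrow> \<Gamma> \<subseteq> \<Gamma>' \<Longrightarrow> \<Delta> \<subseteq> \<Delta>' \<Longrightarrow> G3c_cut_proof {#} (\<Gamma>', \<Delta>')"
  by (simp add: stably_provable_def)

section \<open>Completeness of the propositional rules\<close>

lemma cut_free_rule1:
  assumes "G3c_rule [S'] S" and "G3c_cut_proof {#} S'"
  shows "G3c_cut_proof {#} S"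
  using G3c_cut_proof.Rule[OF assms(1), of "[{#}]"] assms(2) by simp

lemma cut_free_rule2:
  assumes "G3c_rule [S', S''] S" and "G3c_cut_proof {#} S'" and "G3c_cut_proof {#} S''"
  shows "G3c_cut_proof {#} S"
  using G3c_cut_proof.Rule[OF assms(1), of "[{#}, {#}]"] assms(2,3) by simp

text \<open>Backward proof search. \<open>As\<close> and \<open>Bs\<close> hold the formulas still
  to be decomposed, with their total size as measure. The ambient \<open>\<Gamma>\<close> and
  \<open>\<Delta>\<close> only grow and keep every principal formula, so reading a rule upwards
  deletes nothing from the sequent.\<close>

lemma propositional_completeness_list:
  assumes "\<forall>A\<in>set As \<union> set Bs. qfree A" and "\<And>v. \<not> refutes v (set As, set Bs)"
    and "set As \<subseteq> \<Gamma>" and "set Bs \<subseteq> \<Delta>"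
  shows "G3c_cut_proof {#} (\<Gamma>, \<Delta>)"
  using assms
proof (induction "sum_list (map size As) + sum_list (map size Bs)" arbitrary: As Bs \<Gamma> \<Delta>
    rule: less_induct)
  case less
  note IH = less.hyps
  show ?case
  proof (cases "\<forall>A\<in>set As \<union> set Bs. \<exists>P ts. A = Atom P ts")
    case True
    \<comment> \<open>The canonical assignment, true exactly on the atoms of \<open>As\<close>.
      Since it does not refute the lists, some atom of \<open>Bs\<close> is true, hence shared, and
      the sequent is an axiom.\<close>
    let ?v = "\<lambda>P ts. Atom P ts \<in> set As"
    have v: "holds ?v A \<longleftrightarrow> A \<in> set As" if "A \<in> set As \<union> set Bs" for A
    proof -
      from True that obtain P ts where "A = Atom P ts" by blast
      then show ?thesis by simp
    qed
    obtain A where "A \<in> set As" "A \<in> set Bs"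
      using less.prems(2)[of ?v] v by (auto simp: refutes_def)
    with True obtain P ts where "Atom P ts \<in> set As" "Atom P ts \<in> set Bs"
      by (metis UnI1)
    then have "insert (Atom P ts) \<Gamma> = \<Gamma>" "insert (Atom P ts) \<Delta> = \<Delta>"
      using less.prems by auto
    then show ?thesis using G3c_cut_proof.Ax[of P ts \<Gamma> \<Delta>] by simp
  next
    case False
    then obtain A where A: "A \<in> set As \<union> set Bs" and nA: "\<nexists>P ts. A = Atom P ts" by blast
    have qA: "qfree A" using A less.prems by blast
    from A consider "A \<in> set As" | "A \<in> set Bs" by blast
    then show ?thesis
    proof cases
      case 1
      then obtain As1 As2 where As: "As = As1 @ A # As2" by (meson split_list)
      have A\<Gamma>: "insert A \<Gamma> = \<Gamma>" using 1 less.prems by auto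
      \<comment> \<open>One scheme for all left rules: \<open>A\<close> gives way to smaller
        components, \<open>Cs\<close> on the left and \<open>Ds\<close> on the right. As refuting
        the components makes \<open>A\<close> true, an assignment refuting the new lists would
        refute the old ones.\<close>
      have step: "G3c_cut_proof {#} (set Cs \<union> \<Gamma>, set Ds \<union> \<Delta>)"
        if "sum_list (map size Cs) + sum_list (map size Ds) < size A"
          and "\<forall>B\<in>set Cs \<union> set Ds. qfree B"
          and "\<And>v. refutes v (set Cs, set Ds) \<Longrightarrow> holds v A" for Cs Ds
      proof (rule IH[of "Cs @ As1 @ As2" "Ds @ Bs"])
        show "\<not> refutes v (set (Cs @ As1 @ As2), set (Ds @ Bs))" for v
          using less.prems(2)[of v] that(3)[of v] by (auto simp: As refutes_def)
      qed (use that less.prems in \<open>auto simp: As\<close>)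
      show ?thesis
      proof (cases A)
        case (Neg B)
        from step[of "[]" "[B]"] Neg qA have "G3c_cut_proof {#} (\<Gamma>, insert B \<Delta>)"
          by (auto simp: refutes_def)
        from cut_free_rule1[OF NegL this] show ?thesis using A\<Gamma> Neg by simp
      next
        case (And B C)
        from step[of "[B, C]" "[]"] And qA
        have "G3c_cut_proof {#} (insert B (insert C \<Gamma>), \<Delta>)" by (auto simp: refutes_def)
        from cut_free_rule1[OF AndL this] show ?thesis using A\<Gamma> And by simp
      next
        case (Or B C)
        from step[of "[B]" "[]"] step[of "[C]" "[]"] Or qA
        have "G3c_cut_proof {#} (insert B \<Gamma>, \<Delta>)" "G3c_cut_proof {#} (insert C \<Gamma>, \<Delta>)"
          by (auto simp: refutes_def)
        from cut_free_rule2[OF OrL this] show ?thesis using A\<Gamma> Or by simp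
      next
        case (Imp B C)
        from step[of "[]" "[B]"] step[of "[C]" "[]"] Imp qA
        have "G3c_cut_proof {#} (\<Gamma>, insert B \<Delta>)" "G3c_cut_proof {#} (insert C \<Gamma>, \<Delta>)"
          by (auto simp: refutes_def)
        from cut_free_rule2[OF ImpL this] show ?thesis using A\<Gamma> Imp by simp
      qed (use qA nA in auto)
    next
      case 2
      then obtain Bs1 Bs2 where Bs: "Bs = Bs1 @ A # Bs2" by (meson split_list)
      have A\<Delta>: "insert A \<Delta> = \<Delta>" using 2 less.prems by auto
      \<comment> \<open>The mirror image for right rules: refuting the components now makes
        \<open>A\<close> false.\<close>
      have step: "G3c_cut_proof {#} (set Cs \<union> \<Gamma>, set Ds \<union> \<Delta>)"
        if "sum_list (map size Cs) + sum_list (map size Ds) < size A"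
          and "\<forall>B\<in>set Cs \<union> set Ds. qfree B"
          and "\<And>v. refutes v (set Cs, set Ds) \<Longrightarrow> \<not> holds v A" for Cs Ds
      proof (rule IH[of "Cs @ As" "Ds @ Bs1 @ Bs2"])
        show "\<not> refutes v (set (Cs @ As), set (Ds @ Bs1 @ Bs2))" for v
          using less.prems(2)[of v] that(3)[of v] by (auto simp: Bs refutes_def)
      qed (use that less.prems in \<open>auto simp: Bs\<close>)
      show ?thesis
      proof (cases A)
        case (Neg B)
        from step[of "[B]" "[]"] Neg qA have "G3c_cut_proof {#} (insert B \<Gamma>, \<Delta>)"
          by (auto simp: refutes_def)
        from cut_free_rule1[OF NegR this] show ?thesis using A\<Delta> Neg by simp
      next
        case (And B C)
        from step[of "[]" "[B]"] step[of "[]" "[C]"] And qA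
        have "G3c_cut_proof {#} (\<Gamma>, insert B \<Delta>)" "G3c_cut_proof {#} (\<Gamma>, insert C \<Delta>)"
          by (auto simp: refutes_def)
        from cut_free_rule2[OF AndR this] show ?thesis using A\<Delta> And by simp
      next
        case (Or B C)
        from step[of "[]" "[B, C]"] Or qA
        have "G3c_cut_proof {#} (\<Gamma>, insert B (insert C \<Delta>))" by (auto simp: refutes_def)
        from cut_free_rule1[OF OrR this] show ?thesis using A\<Delta> Or by simp
      next
        case (Imp B C)
        from step[of "[B]" "[C]"] Imp qA
        have "G3c_cut_proof {#} (insert B \<Gamma>, insert C \<Delta>)" by (auto simp: refutes_def)
        from cut_free_rule1[OF ImpR this] show ?thesis using A\<Delta> Imp by simp
      qed (use qA nA in auto)
    qed
  qed
qed

lemma propositional_completeness: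
  assumes "finite \<Gamma>" and "finite \<Delta>" and "qfree_seq (\<Gamma>, \<Delta>)" and "\<And>v. \<not> refutes v (\<Gamma>, \<Delta>)"
  shows "stably_provable \<Gamma> \<Delta>"
proof -
  obtain As Bs where "\<Gamma> = set As" "\<Delta> = set Bs"
    using assms(1,2) by (metis finite_list)
  then show ?thesis
    using propositional_completeness_list[of As Bs] assms(3,4)
    by (auto intro!: stably_provableI simp: qfree_seq_def)
qed

section \<open>Introducing quantifier prefixes from their instances\<close>

text \<open>\<open>ForallL\<close> keeps its principal formula in the premise; closure under
  supersets lets the induction hypothesis be used with that copy present.\<close>

lemma stably_provable_Foralls:
  assumes "qfree A" and "distinct zs" and "length ts = length zs"
    and "\<forall>t\<in>set ts. vars t \<inter> set zs = {}"
    and "stably_provable (insert (inst zs ts A) \<Gamma>) \<Delta>"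
  shows "stably_provable (insert (Foralls zs A) \<Gamma>) \<Delta>"
  using assms
proof (induction zs arbitrary: ts A)
  case Nil
  then show ?case by simp
next
  case (Cons z zs)
  then obtain t us where ts: "ts = t # us" by (cases ts) auto
  let ?B = "Foralls zs (subst1 z t A)"
  have IH: "stably_provable (insert ?B \<Gamma>) \<Delta>"
    by (rule Cons.IH[of _ us]) (use Cons.prems inst_Cons[of A z zs t us] ts in auto)
  show ?case
  proof (rule stably_provableI)
    fix \<Gamma>' \<Delta>' assume sub: "insert (Foralls (z # zs) A) \<Gamma> \<subseteq> \<Gamma>'" "\<Delta> \<subseteq> \<Delta>'"
    let ?U = "Forall z (Foralls zs A)"
    have eq: "insert ?U \<Gamma>' = \<Gamma>'" and B: "subst1 z t (Foralls zs A) = ?B"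
      using sub Cons.prems by (auto simp: fsubst_Foralls)
    have "free_for t z (Foralls zs A)"
      using Cons.prems ts by (intro free_for_Foralls) auto
    moreover have "G3c_cut_proof {#} (insert ?B (insert ?U \<Gamma>'), \<Delta>')"
      by (rule stably_provableD[OF IH]) (use sub in auto)
    ultimately have "G3c_cut_proof {#} (insert ?U \<Gamma>', \<Delta>')"
      using cut_free_rule1[OF ForallL] B by metis
    then show "G3c_cut_proof {#} (\<Gamma>', \<Delta>')" using eq by simp
  qed
qed

lemma stably_provable_Existss:
  assumes "qfree A" and "distinct zs" and "length ts = length zs"
    and "\<forall>t\<in>set ts. vars t \<inter> set zs = {}"
    and "stably_provable \<Gamma> (insert (inst zs ts A) \<Delta>)"
  shows "stably_provable \<Gamma> (insert (Existss zs A) \<Delta>)"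
  using assms
proof (induction zs arbitrary: ts A)
  case Nil
  then show ?case by simp
next
  case (Cons z zs)
  then obtain t us where ts: "ts = t # us" by (cases ts) auto
  let ?B = "Existss zs (subst1 z t A)"
  have IH: "stably_provable \<Gamma> (insert ?B \<Delta>)"
    by (rule Cons.IH[of _ us]) (use Cons.prems inst_Cons[of A z zs t us] ts in auto)
  show ?case
  proof (rule stably_provableI)
    fix \<Gamma>' \<Delta>' assume sub: "\<Gamma> \<subseteq> \<Gamma>'" "insert (Existss (z # zs) A) \<Delta> \<subseteq> \<Delta>'"
    let ?U = "Exists z (Existss zs A)"
    have eq: "insert ?U \<Delta>' = \<Delta>'" and B: "subst1 z t (Existss zs A) = ?B"
      using sub Cons.prems by (auto simp: fsubst_Existss)
    have "free_for t z (Existss zs A)"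
      using Cons.prems ts by (intro free_for_Existss) auto
    moreover have "G3c_cut_proof {#} (\<Gamma>', insert ?B (insert ?U \<Delta>'))"
      by (rule stably_provableD[OF IH]) (use sub in auto)
    ultimately have "G3c_cut_proof {#} (\<Gamma>', insert ?U \<Delta>')"
      using cut_free_rule1[OF ExistsR] B by metis
    then show "G3c_cut_proof {#} (\<Gamma>', \<Delta>')" using eq by simp
  qed
qed

text \<open>Instances are absorbed one at a time, and the resulting copies of the quantified formula
  coincide because sequents are sets. With no instance left, the claim is the weakening built into
  \<open>stably_provable\<close>.\<close>

lemma stably_provable_Foralls_instances:
  assumes "qfree A" and "distinct zs"
    and "\<forall>ts\<in>set tss. length ts = length zs \<and> (\<forall>t\<in>set ts. vars t \<inter> set zs = {})"
    and "stably_provable ((\<lambda>ts. inst zs ts A) ` set tss \<union> \<Gamma>) \<Delta>"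
  shows "stably_provable (insert (Foralls zs A) \<Gamma>) \<Delta>"
  using assms
proof (induction tss arbitrary: \<Gamma>)
  case Nil
  then show ?case by (auto simp: stably_provable_def)
next
  case (Cons ts tss)
  have "stably_provable (insert (Foralls zs A) (insert (inst zs ts A) \<Gamma>)) \<Delta>"
    by (rule Cons.IH) (use Cons.prems in auto)
  then have "stably_provable (insert (Foralls zs A) (insert (Foralls zs A) \<Gamma>)) \<Delta>"
    using Cons.prems by (intro stably_provable_Foralls[of A zs ts]) (auto simp: insert_commute)
  then show ?case by simp
qed

lemma stably_provable_Existss_instances:
  assumes "qfree A" and "distinct zs"
    and "\<forall>ts\<in>set tss. length ts = length zs \<and> (\<forall>t\<in>set ts. vars t \<inter> set zs = {})"
    and "stably_provable \<Gamma> ((\<lambda>ts. inst zs ts A) ` set tss \<union> \<Delta>)"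
  shows "stably_provable \<Gamma> (insert (Existss zs A) \<Delta>)"
  using assms
proof (induction tss arbitrary: \<Delta>)
  case Nil
  then show ?case by (auto simp: stably_provable_def)
next
  case (Cons ts tss)
  have "stably_provable \<Gamma> (insert (Existss zs A) (insert (inst zs ts A) \<Delta>))"
    by (rule Cons.IH) (use Cons.prems in auto)
  then have "stably_provable \<Gamma> (insert (Existss zs A) (insert (Existss zs A) \<Delta>))"
    using Cons.prems by (intro stably_provable_Existss[of A zs ts]) (auto simp: insert_commute)
  then show ?case by simp
qed


section \<open>Refuted leaves\<close>

text \<open>Semantic invertibility of the propositional rules; a quantifier rule would have a
  quantified principal formula in \<open>S\<close>. The bound on variables carries freshness of
  \<open>x\<close> and \<open>y\<close> from the root to the leaves.\<close>

lemma G3c_rule_refuted_premise: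
  assumes "G3c_rule Ss S" and "qfree_seq S" and "refutes v S"
  shows "\<exists>S'\<in>set Ss. qfree_seq S' \<and> refutes v S' \<and> fv_seq S' \<subseteq> fv_seq S"
  using assms by cases (auto simp: qfree_seq_def refutes_def fv_seq_def)

lemma G3c_derivation_refuted_leaf:
  assumes "G3c_derivation \<psi>" and "qfree_seq (dtree_root \<psi>)" and "refutes v (dtree_root \<psi>)"
  shows "\<exists>S\<in>leaves \<psi>. qfree_seq S \<and> refutes v S \<and> fv_seq S \<subseteq> fv_seq (dtree_root \<psi>)"
  using assms
proof induction
  case (Leaf S)
  then show ?case by simp
next
  case (Inner \<psi>s S)
  obtain \<phi> where \<phi>: "\<phi> \<in> set \<psi>s" "qfree_seq (dtree_root \<phi>)" "refutes v (dtree_root \<phi>)"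
    "fv_seq (dtree_root \<phi>) \<subseteq> fv_seq S"
    using G3c_rule_refuted_premise[OF Inner.hyps(1), of v] Inner.prems by auto
  then obtain S' where "S' \<in> leaves \<phi>" "qfree_seq S'" "refutes v S'" "fv_seq S' \<subseteq> fv_seq S"
    using Inner.IH by blast
  moreover from this \<phi>(1) have "S' \<in> leaves (Node S \<psi>s)"
    by (cases \<psi>s) auto
  ultimately show ?case by auto
qed

text \<open>As sequents are sets, any member can be singled out as principal, and every compound
  quantifier-free formula has a rule on either side.\<close>

lemma maximal_leaf_atoms:
  assumes "\<nexists>Ss. G3c_rule Ss (\<Gamma>, \<Delta>)" and "qfree_seq (\<Gamma>, \<Delta>)" and "A \<in> \<Gamma> \<union> \<Delta>"
  shows "\<exists>P ts. A = Atom P ts"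
proof -
  have q: "qfree A" using assms(2,3) by (auto simp: qfree_seq_def)
  from assms(3) consider "insert A \<Gamma> = \<Gamma>" | "insert A \<Delta> = \<Delta>" by blast
  then show ?thesis
  proof cases
    case 1
    with assms(1) have "\<nexists>Ss. G3c_rule Ss (insert A \<Gamma>, \<Delta>)" by simp
    then show ?thesis
      using q by (cases A) (auto intro: NegL AndL OrL ImpL)
  next
    case 2
    with assms(1) have "\<nexists>Ss. G3c_rule Ss (\<Gamma>, insert A \<Delta>)" by simp
    then show ?thesis
      using q by (cases A) (auto intro: NegR AndR OrR ImpR)
  qed
qed

lemma DNTA_satisfied:
  assumes "G3c_derivation \<psi>" and "maximal \<psi>"
    and "qfree_seq (dtree_root \<psi>)" and "refutes v (dtree_root \<psi>)"
  obtains S where "S \<in> DNTA \<psi>" and "\<And>L. L \<in> S \<Longrightarrow> literal L" and "\<And>L. L \<in> S \<Longrightarrow> holds v L"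
    and "\<And>L. L \<in> S \<Longrightarrow> fv L \<subseteq> fv_seq (dtree_root \<psi>)"
proof -
  obtain \<Gamma> \<Delta> where leaf: "(\<Gamma>, \<Delta>) \<in> leaves \<psi>" and q: "qfree_seq (\<Gamma>, \<Delta>)"
    and v: "refutes v (\<Gamma>, \<Delta>)" and fv: "fv_seq (\<Gamma>, \<Delta>) \<subseteq> fv_seq (dtree_root \<psi>)"
    using G3c_derivation_refuted_leaf[OF assms(1,3,4)] by auto
  have "\<nexists>Ss. G3c_rule Ss (\<Gamma>, \<Delta>)"
    using leaf assms(2) by (auto simp: maximal_def)
  then have atoms: "\<exists>P ts. A = Atom P ts" if "A \<in> \<Gamma> \<union> \<Delta>" for A
    using maximal_leaf_atoms q that by blast
  have "\<not> tautological (\<Gamma>, \<Delta>)"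
    using v unfolding tautological_def refutes_def by (metis IntD1 IntD2)
  then have "Neg ` \<Delta> \<union> \<Gamma> \<in> DNTA \<psi>"
    using leaf unfolding DNTA_def by blast
  moreover have "literal L \<and> holds v L \<and> fv L \<subseteq> fv_seq (dtree_root \<psi>)"
    if "L \<in> Neg ` \<Delta> \<union> \<Gamma>" for L
  proof -
    from that obtain A where A: "A \<in> \<Delta> \<and> L = Neg A \<or> A \<in> \<Gamma> \<and> L = A" by blast
    then obtain P ts where "A = Atom P ts" using atoms by blast
    then have "literal L" using A by (auto simp: literal_def)
    moreover have "holds v L" using A v by (auto simp: refutes_def)
    moreover have "fv L \<subseteq> fv_seq (\<Gamma>, \<Delta>)" using A by (auto simp: fv_seq_def)
    ultimately show ?thesis using fv by blast
  qed
  ultimately show thesis by (intro that) blast+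
qed

section \<open>Truth of the instances of \<open>E\<close> under a refuting assignment\<close>

locale cut_solution =
  fixes \<G> :: "'f grammar" and x y :: var and \<psi> :: "('f, 'p) dtree"
    and \<A> \<C> :: "('f, 'p) fm set set" and E :: "('f, 'p) fm"
  assumes derivation: "G3c_derivation \<psi>" and maximal: "maximal \<psi>"
    and root_qfree: "qfree_seq (dtree_root \<psi>)" and root_fresh: "{x, y} \<inter> fv_seq (dtree_root \<psi>) = {}"
    and xy: "x \<noteq> y"
    and start: "starting_set x y \<A>" and sol: "\<C> \<in> Sol \<G> x y \<psi> \<A>" and DNF: "is_DNF \<C> E"
begin

lemma clause_literal: "C \<in> \<C> \<Longrightarrow> L \<in> C \<Longrightarrow> literal L"
  using start sol by (auto simp: Sol_def Cl_def starting_set_def)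

lemma E_qfree: "qfree E"
  using is_DNF_qfree[OF DNF] clause_literal by blast

text \<open>Falsity of all \<open>E(\<alpha>, t\<^sub>i)\<close> yields a false literal for each
  clause and each \<open>i\<close>. Then \<open>T'\<^sub>1\<close> and \<open>T'\<^sub>2\<close> put
  a false literal into the satisfied set \<open>S\<close>, and \<open>T'\<^sub>3\<close> makes two
  complementary literals both false.\<close>

lemma E_alpha_t_holds:
  assumes "refutes v (dtree_root \<psi>)"
  shows "\<exists>t\<in>set (t_terms \<G>). holds v (subst2 x (Var (alpha \<G>)) y t E)"
proof (rule ccontr)
  let ?p = "length (t_terms \<G>)" and ?t = "\<lambda>i. t_terms \<G> ! i"
  let ?s = "\<lambda>i. fsubst (Var(x := Var (alpha \<G>), y := ?t i))"
  assume "\<not> ?thesis"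
  then have "\<forall>C\<in>\<C>. \<forall>i<?p. \<exists>L\<in>C. \<not> holds v (?s i L)"
    unfolding holds_fsubst_DNF[OF DNF] by (meson nth_mem)
  \<comment> \<open>Moving the range conditions under the existential allows one choice function of
    both arguments; its values outside the range are arbitrary.\<close>
  then have "\<forall>C i. \<exists>L. C \<in> \<C> \<longrightarrow> i < ?p \<longrightarrow> L \<in> C \<and> \<not> holds v (?s i L)"
    by blast
  then obtain L where L: "\<forall>C i. C \<in> \<C> \<longrightarrow> i < ?p \<longrightarrow> L C i \<in> C \<and> \<not> holds v (?s i (L C i))"
    unfolding choice_iff by blast
  then have LC: "L C i \<in> C" and Lv: "\<not> holds v (?s i (L C i))" if "C \<in> \<C>" "i < ?p" for C i
    using that by blast+
  obtain S where S: "S \<in> DNTA \<psi>"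
    and Sv: "\<And>L. L \<in> S \<Longrightarrow> holds v L" and Sfv: "\<And>L. L \<in> S \<Longrightarrow> fv L \<subseteq> fv_seq (dtree_root \<psi>)"
    by (rule DNTA_satisfied[OF derivation maximal root_qfree assms]) (rule that)
  have "(\<exists>C\<in>\<C>. \<exists>i<?p. subst1 y (?t i) (L C i) \<in> N_part \<G> S) \<or>
        (\<exists>C\<in>\<C>. \<exists>I\<in>I_sets \<G> x y S. \<forall>i<?p. L C i \<in> I) \<or>
        (\<exists>C\<in>\<C>. \<exists>D\<in>\<C>. \<exists>i<?p. \<exists>j<?p. ?s i (L C i) = ?s j (dual (L D j)))"
    using LC by (intro sol[unfolded Sol_def Let_def mem_Collect_eq, THEN conjunct2,
        THEN spec[of _ L], THEN mp, THEN bspec[OF _ S]]) blast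
  then show False
  proof (elim disjE bexE exE conjE)
    fix C i assume C: "C \<in> \<C>" and i: "i < ?p" and N: "subst1 y (?t i) (L C i) \<in> N_part \<G> S"
    have q: "qfree (L C i)" using clause_literal LC C i literal_qfree by blast
    have inS: "subst1 y (?t i) (L C i) \<in> S" using N by (simp add: N_part_def)
    \<comment> \<open>\<open>T'\<^sub>1\<close> substitutes only for \<open>y\<close>, so an
      occurrence of \<open>x\<close> would survive into \<open>S\<close>, whose variables come from
      the root. Hence \<open>x\<close> is absent and the partial substitution agrees with the full
      one.\<close>
    then have "x \<notin> fv (subst1 y (?t i) (L C i))" using Sfv root_fresh by blast
    then have "x \<notin> fv (L C i)" using xy by (auto simp: fv_fsubst_qfree[OF q])
    then have "?s i (L C i) = subst1 y (?t i) (L C i)" by (intro fsubst_cong) auto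
    then show False using Lv[OF C i] Sv[OF inS] by simp
  next
    fix C I assume C: "C \<in> \<C>" and "I \<in> I_sets \<G> x y S" and LI: "\<forall>i<?p. L C i \<in> I"
    \<comment> \<open>The index that witnesses membership in \<open>I_sets\<close> is the one to
      use: all chosen literals of \<open>C\<close> lie in \<open>I\<close>, in particular the one
      chosen for this \<open>i\<close>.\<close>
    then obtain i where i: "i < ?p" and "\<forall>L\<in>I. ?s i L \<in> A_part \<G> S" by (auto simp: I_sets_def)
    then have "?s i (L C i) \<in> S" using LI by (auto simp: A_part_def)
    then show False using Lv[OF C i] Sv by blast
  next
    fix C D i j assume C: "C \<in> \<C>" and D: "D \<in> \<C>" and i: "i < ?p" and j: "j < ?p"
      and eq: "?s i (L C i) = ?s j (dual (L D j))"
    have "literal (L D j)" using clause_literal LC D j by blast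
    then show False
      using Lv[OF C i] Lv[OF D j] by (simp add: eq holds_fsubst_dual)
  qed
qed

text \<open>Truth of all \<open>E(r\<^sub>j, \<beta>\<^sub>j)\<close> yields one true clause per
  index. Then \<open>T\<^sub>1\<close> and \<open>T\<^sub>2\<close> give a true literal whose
  complement lies in the satisfied set \<open>S\<close>, and \<open>T\<^sub>3\<close> makes two
  complementary literals both true.\<close>

lemma E_r_beta_fails:
  assumes "refutes v (dtree_root \<psi>)"
  shows "\<exists>i<length (betas \<G>). \<not> holds v (subst2 x (r_terms \<G> ! i) y (Var (betas \<G> ! i)) E)"
proof (rule ccontr)
  let ?m = "length (betas \<G>)" and ?r = "\<lambda>i. r_terms \<G> ! i"
  let ?s = "\<lambda>i. fsubst (Var(x := ?r i, y := Var (betas \<G> ! i)))"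
  assume "\<not> ?thesis"
  then have "\<forall>i<?m. \<exists>C\<in>\<C>. \<forall>L\<in>C. holds v (?s i L)"
    unfolding holds_fsubst_DNF[OF DNF] by blast
  then have "\<forall>i. \<exists>C. i < ?m \<longrightarrow> C \<in> \<C> \<and> (\<forall>L\<in>C. holds v (?s i L))"
    by blast
  then obtain c where "\<forall>i. i < ?m \<longrightarrow> c i \<in> \<C> \<and> (\<forall>L\<in>c i. holds v (?s i L))"
    unfolding choice_iff by blast
  then have c: "c i \<in> \<C>" and cv: "\<And>L. L \<in> c i \<Longrightarrow> holds v (?s i L)" if "i < ?m" for i
    using that by blast+
  \<comment> \<open>The tuple of true clauses, possibly with repetitions, to which the condition in
    \<open>Cl\<close> is applied.\<close>
  define Cs where "Cs = map c [0..<?m]"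
  have nth: "Cs ! i = c i" if "i < ?m" for i using that by (simp add: Cs_def)
  obtain S where S: "S \<in> DNTA \<psi>" and lit: "\<And>L. L \<in> S \<Longrightarrow> literal L"
    and Sv: "\<And>L. L \<in> S \<Longrightarrow> holds v L" and Sfv: "\<And>L. L \<in> S \<Longrightarrow> fv L \<subseteq> fv_seq (dtree_root \<psi>)"
    using DNTA_satisfied[OF derivation maximal root_qfree assms] by blast
  have Cs: "length Cs = ?m \<and> set Cs \<subseteq> \<C>" using c by (auto simp: Cs_def)
  have Cl: "\<C> \<in> Cl \<G> x y \<psi> \<A>" using sol by (simp add: Sol_def)
  have
    "(\<exists>i<?m. \<exists>L\<in>Cs ! i. subst1 x (?r i) L \<in> dual ` N_part \<G> S) \<or>
     (\<exists>i<?m. \<exists>L\<in>Cs ! i. ?s i L \<in> dual ` B_part \<G> S) \<or>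
     (\<exists>i<?m. \<exists>j<?m. \<exists>L\<in>Cs ! i. \<exists>Q\<in>Cs ! j. ?s i L = ?s j (dual Q))"
    by (intro Cl[unfolded Cl_def Let_def mem_Collect_eq, THEN conjunct2,
        THEN spec[of _ Cs], THEN mp, OF Cs, THEN bspec[OF _ S]])
  then show False
  proof (elim disjE bexE exE conjE imageE)
    fix i L K assume i: "i < ?m" and L: "L \<in> Cs ! i" and K: "K \<in> N_part \<G> S"
      and eq: "subst1 x (?r i) L = dual K"
    have q: "qfree L" using clause_literal c i L nth literal_qfree by blast
    have KS: "K \<in> S" using K by (simp add: N_part_def)
    \<comment> \<open>As for \<open>x\<close> in \<open>T'\<^sub>1\<close>: here only
      \<open>x\<close> is replaced, so an occurrence of \<open>y\<close> in \<open>L\<close> would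
      survive into a literal of \<open>S\<close>.\<close>
    then have "y \<notin> fv (dual K)" using Sfv root_fresh lit fv_dual by blast
    then have "y \<notin> fv L" using xy by (auto simp: eq[symmetric] fv_fsubst_qfree[OF q])
    then have "?s i L = subst1 x (?r i) L" by (intro fsubst_cong) auto
    then show False using cv[of i L] i L nth eq Sv[OF KS] holds_dual[OF lit[OF KS]] by simp
  next
    fix i L K assume i: "i < ?m" and L: "L \<in> Cs ! i" and K: "K \<in> B_part \<G> S"
      and eq: "?s i L = dual K"
    have KS: "K \<in> S" using K by (simp add: B_part_def)
    show False using cv[of i L] i L nth eq Sv[OF KS] holds_dual[OF lit[OF KS]] by simp
  next
    fix i j L Q assume i: "i < ?m" and j: "j < ?m" and L: "L \<in> Cs ! i" and Q: "Q \<in> Cs ! j"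
      and eq: "?s i L = ?s j (dual Q)"
    have "literal Q" using clause_literal c j Q nth by blast
    then show False using cv[of i L] cv[of j Q] i j L Q nth eq by (simp add: holds_fsubst_dual)
  qed
qed

end


section \<open>The proof with cut\<close>

theorem theorem5:
  fixes F G E :: "('f, 'p) fm"
    and xs ys :: "var list"
    and h\<^sub>F h\<^sub>G :: 'f
    and H :: "'f tm set"
    and \<G> :: "'f grammar"
    and S :: "('f tm \<Rightarrow> 'f tm \<Rightarrow> ('f, 'p) fm) \<Rightarrow> ('f, 'p) seq"
    and \<psi> :: "('f, 'p) dtree"
    and x y :: var
    and \<A> \<C> :: "('f, 'p) fm set set"
  assumes "qfree F" and "qfree G" and "distinct xs" and "distinct ys"
    and "G3c_cut_proof {#} ({Foralls xs F}, {Existss ys G})"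
    and "h\<^sub>F \<noteq> h\<^sub>G" and "{h\<^sub>F, h\<^sub>G} \<inter> (funs F \<union> funs G) = {}"
    and "Herbrand_term_set xs F ys G h\<^sub>F h\<^sub>G H"
    and "schematic_Pi2_grammar (length xs) (length ys) \<G>"
    and "insert (alpha \<G>) (set (betas \<G>)) \<inter> (fv F \<union> set xs \<union> fv G \<union> set ys) = {}"
    and "H \<subseteq> language h\<^sub>F h\<^sub>G \<G>"
    and "S = schematic_extended_Herbrand_sequent xs F ys G \<G>"
    and "G3c_derivation \<psi>" and "dtree_root \<psi> = reduced_representation xs F ys G \<G>" and "maximal \<psi>"
    and "x \<noteq> y" and "{x, y} \<inter> insert (alpha \<G>) (set (betas \<G>)) = {}"
    and "{x, y} \<inter> fv_seq ({Foralls xs F}, {Existss ys G}) = {}"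
    and "starting_set x y \<A>"
    and "Sol \<G> x y \<psi> \<A> \<noteq> {}" and "\<C> \<in> Sol \<G> x y \<psi> \<A>"
    and "is_DNF \<C> E" and "fv E = {x, y}"
  shows "G3c_cut_proof {#Forall x (Exists y E)#} ({Foralls xs F}, {Existss ys G})"
proof -
  let ?\<alpha> = "alpha \<G>" and ?\<beta> = "\<lambda>i. betas \<G> ! i" and ?r = "\<lambda>i. r_terms \<G> ! i"
  let ?m = "length (betas \<G>)"
  let ?\<Gamma> = "(\<lambda>u. inst xs u F) ` set (u_tuples \<G>)" and ?\<Delta> = "(\<lambda>v. inst ys v G) ` set (v_tuples \<G>)"
  let ?F = "Foralls xs F" and ?G = "Existss ys G"
  let ?Er = "\<lambda>i. subst2 x (?r i) y (Var (?\<beta> i)) E"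
  note gr = assms(9)[unfolded schematic_Pi2_grammar_def]
  have u: "length u = length xs" "t \<in> set u \<Longrightarrow> vars t \<subseteq> {?\<alpha>}" if "u \<in> set (u_tuples \<G>)" for u t
    using gr that by auto
  have v: "length w = length ys" "t \<in> set w \<Longrightarrow> vars t \<subseteq> set (betas \<G>)"
    if "w \<in> set (v_tuples \<G>)" for w t
    using gr that by auto
  have root: "dtree_root \<psi> = (?\<Gamma>, ?\<Delta>)"
    using assms(14) by (simp add: reduced_representation_def)
  have qfree: "qfree_seq (?\<Gamma>, ?\<Delta>)"
    using assms(1,2) by (auto simp: qfree_seq_def)
  \<comment> \<open>An instance contains only free variables of the end-sequent and nonterminals of
    the grammar; \<open>x\<close> and \<open>y\<close> avoid both.\<close>
  have "fv (inst xs w F) \<inter> {x, y} = {}" if "w \<in> set (u_tuples \<G>)" for w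
    using fv_inst_subset[OF assms(1) u(1)[OF that]] u(2)[OF that] assms(17,18)
    by (fastforce simp: fv_seq_def)
  moreover have "fv (inst ys w G) \<inter> {x, y} = {}" if "w \<in> set (v_tuples \<G>)" for w
    using fv_inst_subset[OF assms(2) v(1)[OF that]] v(2)[OF that] assms(17,18)
    by (fastforce simp: fv_seq_def)
  ultimately have fresh: "{x, y} \<inter> fv_seq (?\<Gamma>, ?\<Delta>) = {}"
    by (auto simp: fv_seq_def)
  interpret cut_solution \<G> x y \<psi> \<A> \<C> E
    using assms root qfree fresh by unfold_locales auto

  \<comment> \<open>Folds all instances back into the end-sequent formulas. The tuples contain only
    \<alpha> or the \<open>\<beta>\<^sub>j\<close>, none of which is bound by a prefix, so nothing
    is captured.\<close>
  have close: "stably_provable (insert ?F \<Gamma>) (insert ?G \<Delta>)"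
    if "stably_provable (?\<Gamma> \<union> \<Gamma>) (?\<Delta> \<union> \<Delta>)" for \<Gamma> \<Delta>
  proof (rule stably_provable_Foralls_instances[where tss = "u_tuples \<G>"])
    show "stably_provable (?\<Gamma> \<union> \<Gamma>) (insert ?G \<Delta>)"
      by (rule stably_provable_Existss_instances[where tss = "v_tuples \<G>"])
        (use assms(2,4,10) v that in \<open>fastforce+\<close>)
  qed (use assms(1,3,10) u in \<open>fastforce+\<close>)

  \<comment> \<open>Left premise of the cut: the \<open>t\<^sub>i\<close> serve as witnesses for
    \<open>y\<close>, then \<alpha> is generalised. It is a legitimate eigenvariable, being absent
    from \<open>F\<close> and \<open>G\<close>, while the cut formula is closed.\<close>
  have left: "G3c_cut_proof {#} ({?F}, insert (Forall x (Exists y E)) {?G})"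
  proof -
    let ?Ex = "subst1 x (Var ?\<alpha>) E"
    \<comment> \<open>Treating \<open>[y]\<close> as a prefix of length one makes the lemma on
      instances applicable with the tuples \<open>[t]\<close>. Successive and simultaneous
      substitution agree since \<alpha> differs from \<open>y\<close>.\<close>
    have two: "inst [y] [t] ?Ex = subst2 x (Var ?\<alpha>) y t E" for t
      unfolding inst_def fsubst_fsubst_qfree[OF E_qfree]
      using assms(16,17) by (intro fsubst_cong) auto
    let ?ts = "map (\<lambda>t. [t]) (t_terms \<G>)"
    let ?Es = "(\<lambda>ts. inst [y] ts ?Ex) ` set ?ts"
    have "stably_provable ?\<Gamma> (?Es \<union> ?\<Delta>)"
    proof (rule propositional_completeness)
      show "qfree_seq (?\<Gamma>, ?Es \<union> ?\<Delta>)"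
        using qfree E_qfree by (auto simp: qfree_seq_def)
      show "\<not> refutes v (?\<Gamma>, ?Es \<union> ?\<Delta>)" for v
      proof
        assume v: "refutes v (?\<Gamma>, ?Es \<union> ?\<Delta>)"
        then have "refutes v (dtree_root \<psi>)"
          by (simp add: root refutes_def)
        with E_alpha_t_holds obtain t
          where "t \<in> set (t_terms \<G>)" "holds v (subst2 x (Var ?\<alpha>) y t E)" by blast
        with v show False by (simp add: refutes_def two ball_Un)
      qed
    qed auto
    then have "stably_provable (?\<Gamma> \<union> {}) (?\<Delta> \<union> ?Es)"
      by (simp add: Un_commute)
    then have "stably_provable {?F} (insert ?G ?Es)"
      by (rule close)
    then have "stably_provable {?F} (?Es \<union> {?G})"
      by simp
    moreover have "t \<in> set (t_terms \<G>) \<Longrightarrow> y \<notin> vars t" for t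
      using gr assms(17) by auto
    ultimately have "stably_provable {?F} (insert (Existss [y] ?Ex) {?G})"
      using E_qfree by (intro stably_provable_Existss_instances[where tss = ?ts]) auto
    moreover have "Existss [y] ?Ex = subst1 x (Var ?\<alpha>) (Exists y E)"
      using xy by (simp add: fun_upd_idem)
    ultimately have "G3c_cut_proof {#} ({?F}, insert (subst1 x (Var ?\<alpha>) (Exists y E)) {?G})"
      by (metis stably_provableD subset_refl)
    then show ?thesis
      by (rule cut_free_rule1[OF ForallR, rotated 2])
        (use assms(10,17,23) E_qfree in \<open>auto simp: fv_seq_def free_for_qfree\<close>)
  qed

  \<comment> \<open>The left side once the first \<open>j\<close> instances of the cut formula have
    been unfolded; the cut formula stays, as \<open>ForallL\<close> retains it.\<close>
  define \<Gamma>r where "\<Gamma>r j = insert (Forall x (Exists y E)) (insert ?F (?Er ` {..<j}))" for j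
  have r_vars: "vars (?r i) \<subseteq> set (take i (betas \<G>))" if "i < ?m" for i
    using gr that by auto
  \<comment> \<open>Downward induction from \<open>?m\<close>, where only a propositional check
    remains, to \<open>0\<close>, the right premise of the cut.\<close>
  have right: "G3c_cut_proof {#} (\<Gamma>r j, {?G})" if "j \<le> ?m" for j
    using that
  proof (induction rule: inc_induct)
    case base
    have "stably_provable (?\<Gamma> \<union> ?Er ` {..<?m}) (?\<Delta> \<union> {})"
    proof (rule propositional_completeness)
      show "qfree_seq (?\<Gamma> \<union> ?Er ` {..<?m}, ?\<Delta> \<union> {})"
        using qfree E_qfree by (auto simp: qfree_seq_def)
      show "\<not> refutes v (?\<Gamma> \<union> ?Er ` {..<?m}, ?\<Delta> \<union> {})" for v
      proof
        assume v: "refutes v (?\<Gamma> \<union> ?Er ` {..<?m}, ?\<Delta> \<union> {})"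
        then have "refutes v (dtree_root \<psi>)"
          by (simp add: root refutes_def)
        with E_r_beta_fails obtain i where "i < ?m" "\<not> holds v (?Er i)" by blast
        with v show False by (simp add: refutes_def ball_Un)
      qed
    qed auto
    \<comment> \<open>The cut formula enters here by weakening.\<close>
    from close[OF this] show ?case
      by (rule stably_provableD) (auto simp: \<Gamma>r_def)
  next
    case (step j)
    let ?Ey = "subst1 x (?r j) (Exists y E)"
    have Ey: "?Ey = Exists y (subst1 x (?r j) E)"
      using xy by (simp add: fun_upd_idem)
    have r_betas: "vars (?r i) \<subseteq> set (betas \<G>)" if "i < ?m" for i
      using r_vars[OF that] set_take_subset by fast
    have r_y: "y \<notin> vars (?r j)"
      using r_betas step.hyps assms(17) by blast
    \<comment> \<open>\<open>ForallL\<close> and \<open>ExistsL\<close> substitute for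
      \<open>x\<close> and \<open>y\<close> in turn; this equals the simultaneous substitution
      because \<open>y\<close> does not occur in \<open>r\<^sub>j\<close>.\<close>
    have Er: "?Er j = subst1 y (Var (?\<beta> j)) (subst1 x (?r j) E)"
    proof -
      have "tsubst (Var(y := Var (?\<beta> j))) (?r j) = tsubst Var (?r j)"
        using r_y by (intro tsubst_cong) auto
      then show ?thesis
        unfolding fsubst_fsubst_qfree[OF E_qfree] using xy by (intro fsubst_cong) auto
    qed
    \<comment> \<open>Source of the eigenvariable condition: the nonterminals are distinct, and each
      \<open>r\<^sub>i\<close> mentions only those before \<open>\<beta>\<^sub>i\<close>.\<close>
    have fresh_take: "?\<beta> j \<notin> set (take i (betas \<G>))" if "i \<le> j" for i
      using gr step.hyps that by (auto simp: in_set_conv_nth nth_eq_iff_index_eq)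
    \<comment> \<open>\<open>take (Suc i)\<close> accounts for \<open>\<beta>\<^sub>i\<close>
      itself, besides the variables of \<open>r\<^sub>i\<close> in \<open>take i\<close>.\<close>
    have fresh_E: "?\<beta> j \<notin> fv (?Er i)" if "i < j" for i
      using r_vars[of i] fresh_take[of i] fresh_take[of "Suc i"] that step.hyps xy
      by (auto simp: fv_fsubst_qfree[OF E_qfree] assms(23) take_Suc_conv_app_nth)
    have \<beta>: "?\<beta> j \<in> set (betas \<G>)" using step.hyps by simp
    have fresh_Ey: "?\<beta> j \<notin> fv ?Ey"
      using r_vars[of j] fresh_take[of j] step.hyps \<beta> xy
      by (auto simp: Ey fv_fsubst_qfree[OF E_qfree] assms(23))
    have "?\<beta> j \<notin> fv_seq (insert ?Ey (\<Gamma>r j), {?G})"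
      using fresh_E fresh_Ey \<beta> assms(10) by (auto simp: fv_seq_def \<Gamma>r_def assms(23))
    moreover have "\<Gamma>r (Suc j) = insert (?Er j) (\<Gamma>r j)"
      by (auto simp: \<Gamma>r_def lessThan_Suc)
    \<comment> \<open>\<open>ExistsL\<close> with eigenvariable \<open>\<beta>\<^sub>j\<close> leads
      from \<open>\<Gamma>r (Suc j)\<close> to the instance of the cut formula at
      \<open>r\<^sub>j\<close>; \<open>ForallL\<close> then merges that instance into the cut
      formula already in \<open>\<Gamma>r j\<close>.\<close>
    ultimately have "G3c_cut_proof {#} (insert ?Ey (\<Gamma>r j), {?G})"
      using step.IH E_qfree unfolding Ey Er
      by (intro cut_free_rule1[OF ExistsL[where a = "?\<beta> j"]]) (auto simp: free_for_qfree)
    moreover have "insert (Forall x (Exists y E)) (\<Gamma>r j) = \<Gamma>r j"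
      by (auto simp: \<Gamma>r_def)
    moreover have "free_for (?r j) x (Exists y E)"
      using r_y E_qfree by (simp add: free_for_qfree)
    ultimately show ?case
      using cut_free_rule1[OF ForallL[of "?r j" x "Exists y E" "\<Gamma>r j" "{?G}"]] by simp
  qed
  have "G3c_cut_proof {#} (insert (Forall x (Exists y E)) {?F}, {?G})"
    using right[of 0] by (simp add: \<Gamma>r_def)
  \<comment> \<open>Both premises are cut-free, so the multiset is a singleton; the equal contexts
    merge as sets.\<close>
  from Cut[OF left this] show ?thesis by simp
qed

end
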